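(* For any reversible chain, $$\frac12\sum_{i=2}^n\lambda_i^2-\frac16\sum_{x\in S}\pi(x)\,T_3(x)\;\le\;I(X_0;X_1)\;\le\;\sum_{i=2}^n\lambda_i^2.$$ When $\max_{x,y}|g(x,y)|\le C$ for a constant $C$ independent of $n$, one has $\sum_x\pi(x)T_3(x)\le C\sum_{i\ge2}\lambda_i^2$, so the lower bound simplifies to $$I(X_0;X_1)\ge\Bigl(\frac12-\frac C6\Bigr)\sum_{i\ge2}\lambda_i^2,$$ which is positive when $C<3$.
   Context: $P$ is a Markov transition kernel on a finite state space $S$ with $|S|=n\ge2$, with a stationary distribution $\pi$ of full support ($\pi(x)>0$ for all $x\in S$). Reversible means $\pi(x)P(x,y)=\pi(y)P(y,x)$ for all $x,y\in S$. $1=\lambda_1\ge\lambda_2\ge\cdots\ge\lambda_n\ge-1$ are the eigenvalues of $P$ in $L^2(\pi)$. $g(x,y):=\frac{P(x,y)}{\pi(y)}-1$ and $T_3(x):=\sum_{y\in S}\pi(y)|g(x,y)|^3$. $(X_0,X_1)$ is the stationary one-step pair: $X_0\sim\pi$, $X_1\mid X_0=x\sim P(x,\cdot)$, with mutual information $I(X_0;X_1):=\sum_{x,y\in S}\pi(x)P(x,y)\log\frac{P(x,y)}{\pi(y)}$. All logarithms are natural, with $0\log0=0$.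
   Formalization: Positivity of the whole lower bound when C<3 is stated only if some λ_i with i≥2 is nonzero (for P(x,y)=π(y) the bound is 0); positivity of the coefficient 1/2−C/6 is unconditional. *)

theory Defs
  imports "HOL-Analysis.Analysis" "HOL-Probability.Probability"
begin

definition reversible :: "('s \<Rightarrow> 's pmf) \<Rightarrow> 's pmf \<Rightarrow> bool" where
  "reversible P \<pi> \<longleftrightarrow> (\<forall>x y. pmf \<pi> x * pmf (P x) y = pmf \<pi> y * pmf (P y) x)"

text \<open>The action of \<open>P\<close> on functions. The state space is finite and \<open>\<pi>\<close> has full support,
  so the vector space underlying \<open>L\<^sup>2(\<pi>)\<close> is the space of all functions \<open>'s \<rightarrow> \<real>\<close>,
  here \<open>real ^ 's\<close>; eigenvalues and eigenspaces do not involve the inner product.\<close>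

definition transition_op :: "('s::finite \<Rightarrow> 's pmf) \<Rightarrow> real ^ 's \<Rightarrow> real ^ 's" where
  "transition_op P f = (\<chi> x. \<Sum>y\<in>UNIV. pmf (P x) y * f $ y)"

definition eigenspace :: "('s::finite \<Rightarrow> 's pmf) \<Rightarrow> real \<Rightarrow> (real ^ 's) set" where
  "eigenspace P t = {f. transition_op P f = t *\<^sub>R f}"

definition spectrum_of :: "('s::finite \<Rightarrow> 's pmf) \<Rightarrow> real set" where
  "spectrum_of P = {t. \<exists>f \<in> eigenspace P t. f \<noteq> 0}"

text \<open>The eigenvalues in decreasing order, each repeated according to the dimension of its
  eigenspace. For a reversible chain \<open>P\<close> is self-adjoint on \<open>L\<^sup>2(\<pi>)\<close>, so that the list has
  exactly \<open>CARD('s)\<close> entries.\<close>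

definition eigenvalue_list :: "('s::finite \<Rightarrow> 's pmf) \<Rightarrow> real list" where
  "eigenvalue_list P =
     concat (map (\<lambda>t. replicate (dim (eigenspace P t)) t) (rev (sorted_list_of_set (spectrum_of P))))"

text \<open>Indexing starts at \<open>1\<close>, so \<open>eigenval P 1\<close> is the largest eigenvalue.\<close>

definition eigenval :: "('s::finite \<Rightarrow> 's pmf) \<Rightarrow> nat \<Rightarrow> real" where
  "eigenval P i = eigenvalue_list P ! (i - 1)"

definition rel_dev :: "('s \<Rightarrow> 's pmf) \<Rightarrow> 's pmf \<Rightarrow> 's \<Rightarrow> 's \<Rightarrow> real" where
  "rel_dev P \<pi> x y = pmf (P x) y / pmf \<pi> y - 1"

definition T3 :: "('s::finite \<Rightarrow> 's pmf) \<Rightarrow> 's pmf \<Rightarrow> 's \<Rightarrow> real" where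
  "T3 P \<pi> x = (\<Sum>y\<in>UNIV. pmf \<pi> y * \<bar>rel_dev P \<pi> x y\<bar> ^ 3)"

text \<open>Mutual information of the stationary one-step pair, in nats. Summands with
  \<open>pmf (P x) y = 0\<close> vanish, which is the convention \<open>0 log 0 = 0\<close>.\<close>

definition one_step_info :: "('s::finite \<Rightarrow> 's pmf) \<Rightarrow> 's pmf \<Rightarrow> real" where
  "one_step_info P \<pi> =
     (\<Sum>x\<in>UNIV. \<Sum>y\<in>UNIV. pmf \<pi> x * pmf (P x) y * ln (pmf (P x) y / pmf \<pi> y))"

end

(* Conjugating P by the square root of pi gives a symmetric matrix; its Hilbert-Schmidt norm, computed
   in an orthonormal eigenbasis and in the standard basis, shows that the squared eigenvalues sum to
   the sum of pi(x) P(x,y)^2 / pi(y), which is 1 plus the mean of g^2 under pi x pi. The top eigenvalue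
   is 1, so the mean of g^2 is the sum of the squared nontrivial eigenvalues. Since g has mean zero
   and the mutual information is the mean of (1+g) ln (1+g), everything follows from
   g + g^2/2 - |g|^3/6 <= (1+g) ln (1+g) <= g + g^2. *)
theory Submission
  imports Defs
begin

section \<open>Self-adjoint operators on a Euclidean space\<close>

text \<open>First-order condition at a minimum: the quadratic in \<open>s\<close> vanishes at
  \<open>0\<close> and is nowhere negative, so its slope there is zero.\<close>

lemma linear_term_zero_of_nonneg:
  fixes a b :: real
  assumes "\<And>s. 0 \<le> 2 * s * a + s\<^sup>2 * b"
  shows "a = 0"
proof -
  \<comment> \<open>\<open>c\<close> is a positive majorant of \<open>b\<close>; at
    \<open>s = - a / c\<close> the quadratic is then at most
    \<open>- (a\<^sup>2 / c)\<close>.\<close>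
  define c where "c = \<bar>b\<bar> + 1"
  have c: "c > 0" "b \<le> c" by (auto simp: c_def)
  have "0 \<le> 2 * (- a / c) * a + (- a / c)\<^sup>2 * b" by (rule assms)
  also have "\<dots> \<le> 2 * (- a / c) * a + (- a / c)\<^sup>2 * c"
    by (intro add_left_mono mult_left_mono c) auto
  also have "\<dots> = - (a\<^sup>2 / c)"
    using c by (simp add: power2_eq_square field_simps)
  finally have "a\<^sup>2 / c \<le> 0" by simp
  then show ?thesis using c by (simp add: divide_le_0_iff)
qed

text \<open>The eigenvector is a maximiser of the Rayleigh quotient on the unit sphere of \<open>W\<close>.\<close>

lemma selfadjoint_eigenvector_exists:
  fixes A :: "'a::euclidean_space \<Rightarrow> 'a"
  assumes "linear A" and sa: "\<And>u v. A u \<bullet> v = u \<bullet> A v"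
    and W: "subspace W" and inv: "\<And>w. w \<in> W \<Longrightarrow> A w \<in> W"
    and w0: "w0 \<in> W" "w0 \<noteq> 0"
  obtains t v where "v \<in> W" "v \<noteq> 0" "A v = t *\<^sub>R v"
proof -
  interpret linear A by fact
  have "compact (W \<inter> sphere 0 1)"
    by (intro closed_Int_compact closed_subspace W) simp
  moreover have "sgn w0 \<in> W \<inter> sphere 0 1"
    using w0 subspace_scale[OF W] by (simp add: sgn_div_norm)
  moreover have "continuous_on (W \<inter> sphere 0 1) (\<lambda>x. x \<bullet> A x)"
    by (intro continuous_intros linear_continuous_on linear_conv_bounded_linear[THEN iffD1] \<open>linear A\<close>)
  ultimately have "\<exists>v\<in>W \<inter> sphere 0 1. \<forall>x\<in>W \<inter> sphere 0 1. x \<bullet> A x \<le> v \<bullet> A v"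
    by (intro continuous_attains_sup) auto
  then obtain v where v: "v \<in> W" "norm v = 1"
    and max: "\<And>x. x \<in> W \<Longrightarrow> norm x = 1 \<Longrightarrow> x \<bullet> A x \<le> v \<bullet> A v"
    by auto
  define m where "m = v \<bullet> A v"
  have rayleigh: "x \<bullet> A x \<le> m * (x \<bullet> x)" if "x \<in> W" for x
  proof (cases "x = 0")
    case False
    have "sgn x \<bullet> A (sgn x) \<le> m"
      unfolding m_def using that False subspace_scale[OF W] by (intro max) (auto simp: sgn_div_norm)
    then show ?thesis
      using False by (simp add: sgn_div_norm scale field_simps power2_eq_square flip: power2_norm_eq_inner)
  qed (simp add: zero)
  \<comment> \<open>The residual of the eigenvalue equation serves as the direction of perturbation:
    the term linear in \<open>s\<close> becomes \<open>2 * s * (y \<bullet> y)\<close>, so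
    maximality at \<open>v\<close> forces \<open>y = 0\<close>.\<close>
  define y where "y = m *\<^sub>R v - A v"
  have y: "y \<in> W"
    unfolding y_def using v W inv by (auto intro: subspace_diff subspace_scale)
  have vv: "v \<bullet> v = 1" using v by (simp add: norm_eq_1)
  have "0 \<le> 2 * s * (y \<bullet> y) + s\<^sup>2 * (m * (y \<bullet> y) - y \<bullet> A y)" for s
  proof -
    have "0 \<le> m * ((v + s *\<^sub>R y) \<bullet> (v + s *\<^sub>R y)) - (v + s *\<^sub>R y) \<bullet> A (v + s *\<^sub>R y)"
      using rayleigh[of "v + s *\<^sub>R y"] y v W by (auto intro: subspace_add subspace_scale)
    also have "\<dots> = 2 * s * (m * (v \<bullet> y) - A v \<bullet> y) + s\<^sup>2 * (m * (y \<bullet> y) - y \<bullet> A y)"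
      using vv sa[of v y]
      by (simp add: m_def[symmetric] add scale inner_add_left inner_add_right power2_eq_square
          algebra_simps inner_commute[of y v] inner_commute[of y "A v"])
    also have "m * (v \<bullet> y) - A v \<bullet> y = y \<bullet> y"
      by (simp add: y_def inner_diff_left)
    finally show ?thesis .
  qed
  then have "y \<bullet> y = 0" by (rule linear_term_zero_of_nonneg)
  then have "A v = m *\<^sub>R v" by (simp add: y_def)
  then show ?thesis using that v by force
qed

lemma parseval:
  fixes B :: "'a::euclidean_space set"
  assumes "pairwise orthogonal B" "\<And>b. b \<in> B \<Longrightarrow> norm b = 1" "finite B" "span B = UNIV"
  shows "(norm x)\<^sup>2 = (\<Sum>b\<in>B. (x \<bullet> b)\<^sup>2)"
proof -
  have "(norm x)\<^sup>2 = x \<bullet> (\<Sum>b\<in>B. (x \<bullet> b) *\<^sub>R b)"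
    using assms by (subst orthonormal_basis_expand) (auto simp: power2_norm_eq_inner)
  then show ?thesis by (simp add: inner_sum_right power2_eq_square)
qed

text \<open>Eigenvectors for distinct eigenvalues are orthogonal, so orthonormal bases of the
  eigenspaces join to an orthonormal set \<open>U\<close>. It spans, since otherwise its nonzero,
  invariant orthogonal complement would contain a further eigenvector. Counting \<open>U\<close>
  gives the dimension; summing the squared norms of \<open>A\<close> over it gives the
  Hilbert-Schmidt norm.\<close>

lemma selfadjoint_eigenspaces:
  fixes A :: "'a::euclidean_space \<Rightarrow> 'a"
  assumes "linear A" and sa: "\<And>u v. A u \<bullet> v = u \<bullet> A v"
  defines "E \<equiv> \<lambda>t. {v. A v = t *\<^sub>R v}"
  defines "\<Lambda> \<equiv> {t. \<exists>v\<in>E t. v \<noteq> 0}"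
  shows "finite \<Lambda>" "(\<Sum>t\<in>\<Lambda>. dim (E t)) = DIM('a)"
    "(\<Sum>t\<in>\<Lambda>. real (dim (E t)) * t\<^sup>2) = (\<Sum>b\<in>Basis. (norm (A b))\<^sup>2)"
proof -
  interpret linear A by fact
  have sub: "subspace (E t)" for t
    by (auto simp: subspace_def E_def add scale zero algebra_simps)
  have "\<exists>B. B \<subseteq> E t \<and> pairwise orthogonal B \<and> (\<forall>x\<in>B. norm x = 1) \<and> card B = dim (E t) \<and> span B = E t" for t
    using orthonormal_basis_subspace[OF sub[of t]] by metis
  then obtain B where B: "\<And>t. B t \<subseteq> E t" "\<And>t. pairwise orthogonal (B t)"
    "\<And>t x. x \<in> B t \<Longrightarrow> norm x = 1" "\<And>t. card (B t) = dim (E t)" "\<And>t. span (B t) = E t"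
    by metis
  have AB: "A b = t *\<^sub>R b" if "b \<in> B t" for b t
    using B(1)[of t] that by (auto simp: E_def)
  have uniq: "s = t" if "b \<in> B s" "b \<in> B t" for b s t
    using AB[OF that(1)] AB[OF that(2)] B(3)[OF that(1)] by auto
  have orth: "orthogonal b c" if "b \<in> B s" "c \<in> B t" "b \<noteq> c" for b c s t
  proof (cases "s = t")
    case True
    then show ?thesis using B(2)[of t] that by (auto simp: pairwise_def)
  next
    case False
    have "s * (b \<bullet> c) = t * (b \<bullet> c)"
      using sa[of b c] AB[OF that(1)] AB[OF that(2)] by simp
    then show ?thesis using False by (simp add: orthogonal_def)
  qed
  \<comment> \<open>\<open>U\<close> is formed before \<open>\<Lambda>\<close> is known to be
    finite. Independence makes \<open>U\<close> finite, and every eigenvalue is recovered as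
    \<open>b \<bullet> A b\<close> from some \<open>b\<close> in \<open>U\<close>.\<close>
  define U where "U = (\<Union>t\<in>\<Lambda>. B t)"
  have orthU: "pairwise orthogonal U"
    using orth by (auto simp: U_def pairwise_def)
  have normU: "norm b = 1" if "b \<in> U" for b using that B(3) by (auto simp: U_def)
  have indep: "independent U"
    by (rule pairwise_orthogonal_independent[OF orthU]) (use normU in force)
  have finU: "finite U" by (rule finiteI_independent[OF indep])
  have ne: "B t \<noteq> {}" if "t \<in> \<Lambda>" for t
    using that B(5)[of t] by (force simp: \<Lambda>_def)
  have "t = b \<bullet> A b" if "b \<in> B t" for b t
    using AB[OF that] B(3)[OF that] by (simp add: norm_eq_1)
  then have "\<Lambda> \<subseteq> (\<lambda>b. b \<bullet> A b) ` U"
    using ne by (force simp: U_def)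
  then show finL: "finite \<Lambda>" using finU finite_surj by blast
  have span: "span U = UNIV"
  proof (rule ccontr)
    assume "span U \<noteq> UNIV"
    then have "span U \<subset> span UNIV" by auto
    then obtain w where w: "w \<noteq> 0" "\<And>y. y \<in> span U \<Longrightarrow> orthogonal w y"
      by (rule orthogonal_to_subspace_exists_gen) auto
    define W where "W = {x. \<forall>b\<in>U. x \<bullet> b = 0}"
    have "subspace W" by (auto simp: W_def subspace_def inner_add_left)
    moreover have "A x \<in> W" if "x \<in> W" for x
      using that sa AB by (auto simp: W_def U_def)
    moreover have "w \<in> W" using w by (auto simp: W_def orthogonal_def span_base)
    ultimately obtain t v where v: "v \<in> W" "v \<noteq> 0" "A v = t *\<^sub>R v"
      using w(1) by (rule selfadjoint_eigenvector_exists[OF \<open>linear A\<close> sa])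
    \<comment> \<open>As an eigenvector, \<open>v\<close> lies in the span of \<open>B t\<close>,
      which is part of \<open>U\<close>; lying also in the complement of \<open>U\<close>, it is
      orthogonal to itself.\<close>
    then have "t \<in> \<Lambda>" and span_v: "v \<in> span (B t)" using B(5) by (auto simp: \<Lambda>_def E_def)
    then have "orthogonal v v"
      using v(1) by (intro orthogonal_to_span[OF span_v]) (auto simp: W_def U_def orthogonal_def)
    then show False using v(2) by (simp add: orthogonal_def)
  qed
  have fin: "\<forall>t\<in>\<Lambda>. finite (B t)" using finite_subset[OF _ finU] by (auto simp: U_def)
  have disj: "\<forall>s\<in>\<Lambda>. \<forall>t\<in>\<Lambda>. s \<noteq> t \<longrightarrow> B s \<inter> B t = {}" using uniq by blast
  have "card U = (\<Sum>t\<in>\<Lambda>. card (B t))"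
    unfolding U_def by (rule card_UN_disjoint[OF finL fin disj])
  moreover have "card U = DIM('a)"
    using dim_eq_card[OF _ indep, of UNIV] span by simp
  ultimately show "(\<Sum>t\<in>\<Lambda>. dim (E t)) = DIM('a)" by (simp add: B(4))
  have symA: "A b \<bullet> c = A c \<bullet> b" for b c by (metis sa inner_commute)
  \<comment> \<open>Parseval in \<open>U\<close>, then self-adjointness to move \<open>A\<close>
    onto the other vector, then Parseval in the standard basis.\<close>
  have "(\<Sum>b\<in>Basis. (norm (A b))\<^sup>2) = (\<Sum>b\<in>Basis. \<Sum>c\<in>U. (A b \<bullet> c)\<^sup>2)"
    by (intro sum.cong parseval[OF orthU normU finU span]) auto
  also have "\<dots> = (\<Sum>c\<in>U. \<Sum>b\<in>Basis. (A c \<bullet> b)\<^sup>2)"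
    by (subst sum.swap) (intro sum.cong refl arg_cong[of _ _ power2] symA)
  also have "\<dots> = (\<Sum>c\<in>U. (norm (A c))\<^sup>2)"
    by (rule sum.cong[OF refl], rule parseval[symmetric])
      (auto simp: pairwise_def orthogonal_def inner_Basis)
  also have "\<dots> = (\<Sum>t\<in>\<Lambda>. \<Sum>c\<in>B t. (norm (A c))\<^sup>2)"
    unfolding U_def by (rule sum.UNION_disjoint[OF finL fin disj])
  also have "\<dots> = (\<Sum>t\<in>\<Lambda>. \<Sum>c\<in>B t. t\<^sup>2)"
    by (intro sum.cong refl) (simp add: AB B(3))
  finally show "(\<Sum>t\<in>\<Lambda>. real (dim (E t)) * t\<^sup>2) = (\<Sum>b\<in>Basis. (norm (A b))\<^sup>2)"
    by (simp add: B(4))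
qed

section \<open>Spectrum of a reversible chain\<close>

text \<open>Conjugating by the square root of \<open>\<pi>\<close> carries \<open>L\<^sup>2(\<pi>)\<close> to the standard inner product,
  where \<open>P\<close> becomes a symmetric matrix.\<close>

definition sym_kernel :: "('s::finite \<Rightarrow> 's pmf) \<Rightarrow> 's pmf \<Rightarrow> real ^ 's ^ 's" where
  "sym_kernel P \<pi> = (\<chi> x y. sqrt (pmf \<pi> x) * pmf (P x) y / sqrt (pmf \<pi> y))"

definition sqrt_weight :: "'s::finite pmf \<Rightarrow> real ^ 's \<Rightarrow> real ^ 's" where
  "sqrt_weight \<pi> f = (\<chi> x. sqrt (pmf \<pi> x) * f $ x)"

lemma linear_sqrt_weight: "linear (sqrt_weight \<pi>)"
  by (auto simp: linear_iff sqrt_weight_def vec_eq_iff algebra_simps)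

lemma inj_sqrt_weight:
  assumes "\<forall>x. pmf \<pi> x > 0"
  shows "inj (sqrt_weight \<pi>)"
proof (rule injI)
  fix f g :: "real ^ 'a"
  assume "sqrt_weight \<pi> f = sqrt_weight \<pi> g"
  moreover have "sqrt (pmf \<pi> x) \<noteq> 0" for x using assms[rule_format, of x] by simp
  ultimately show "f = g" by (simp add: sqrt_weight_def vec_eq_iff)
qed

lemma surj_sqrt_weight:
  assumes "\<forall>x. pmf \<pi> x > 0"
  shows "surj (sqrt_weight \<pi>)"
  by (rule linear_injective_imp_surjective[OF linear_sqrt_weight inj_sqrt_weight[OF assms]]) simp

text \<open>After clearing the square roots in the denominators, symmetry is the detailed balance
  equation.\<close>

lemma sym_kernel_symmetric:
  assumes pos: "\<forall>x. pmf \<pi> x > 0" and rev: "reversible P \<pi>"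
  shows "transpose (sym_kernel P \<pi>) = sym_kernel P \<pi>"
proof -
  have "sqrt (pmf \<pi> y) * pmf (P y) x / sqrt (pmf \<pi> x) = sqrt (pmf \<pi> x) * pmf (P x) y / sqrt (pmf \<pi> y)"
    for x y
  proof -
    have sq: "sqrt (pmf \<pi> z) * (sqrt (pmf \<pi> z) * b) = pmf \<pi> z * b" for z b
      by (simp flip: mult.assoc)
    have "sqrt (pmf \<pi> y) * (sqrt (pmf \<pi> y) * pmf (P y) x) = sqrt (pmf \<pi> x) * (sqrt (pmf \<pi> x) * pmf (P x) y)"
      using rev unfolding sq reversible_def by simp
    moreover have "pmf \<pi> x > 0" "pmf \<pi> y > 0" using pos by auto
    ultimately show ?thesis by (simp add: field_simps)
  qed
  then show ?thesis by (simp add: transpose_def sym_kernel_def vec_eq_iff)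
qed

lemma sym_kernel_selfadjoint:
  assumes "\<forall>x. pmf \<pi> x > 0" and "reversible P \<pi>"
  shows "(sym_kernel P \<pi> *v u) \<bullet> v = u \<bullet> (sym_kernel P \<pi> *v v)"
  by (metis dot_lmul_matrix sym_kernel_symmetric[OF assms] transpose_matrix_vector)

text \<open>The intertwining relation through which, \<open>sqrt_weight\<close> being bijective,
  eigenspaces, their dimensions and the spectrum are carried over.\<close>

lemma sym_kernel_sqrt_weight:
  assumes "\<forall>x. pmf \<pi> x > 0"
  shows "sym_kernel P \<pi> *v sqrt_weight \<pi> f = sqrt_weight \<pi> (transition_op P f)"
proof -
  have "sqrt (pmf \<pi> x) \<noteq> 0" for x using assms[rule_format, of x] by simp
  then show ?thesis
    by (simp add: vec_eq_iff matrix_vector_mult_def sym_kernel_def sqrt_weight_def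
        transition_op_def sum_distrib_left mult.assoc)
qed

lemma eigenspace_sym_kernel:
  assumes "\<forall>x. pmf \<pi> x > 0"
  shows "{v. sym_kernel P \<pi> *v v = t *\<^sub>R v} = sqrt_weight \<pi> ` eigenspace P t"
proof -
  have "sym_kernel P \<pi> *v sqrt_weight \<pi> f = t *\<^sub>R sqrt_weight \<pi> f \<longleftrightarrow> f \<in> eigenspace P t" for f
    using inj_sqrt_weight[OF assms]
    by (simp add: sym_kernel_sqrt_weight[OF assms] eigenspace_def inj_eq
        flip: linear_scale[OF linear_sqrt_weight])
  then show ?thesis using surj_sqrt_weight[OF assms] by (auto simp: surj_def) (metis image_eqI)
qed

lemma dim_eigenspace_sym_kernel:
  assumes "\<forall>x. pmf \<pi> x > 0"
  shows "dim {v. sym_kernel P \<pi> *v v = t *\<^sub>R v} = dim (eigenspace P t)"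
  unfolding eigenspace_sym_kernel[OF assms]
  by (rule dim_image_eq[OF linear_sqrt_weight inj_on_subset[OF inj_sqrt_weight[OF assms] subset_UNIV]])

lemma spectrum_sym_kernel:
  assumes "\<forall>x. pmf \<pi> x > 0"
  shows "{t. \<exists>v\<in>{v. sym_kernel P \<pi> *v v = t *\<^sub>R v}. v \<noteq> 0} = spectrum_of P"
proof -
  have "sqrt_weight \<pi> f = 0 \<longleftrightarrow> f = 0" for f
    using inj_sqrt_weight[OF assms] linear_0[OF linear_sqrt_weight, of \<pi>] by (metis injD)
  then show ?thesis unfolding eigenspace_sym_kernel[OF assms] spectrum_of_def by simp
qed

text \<open>Applying the kernel to \<open>axis y 1\<close> picks out its column \<open>y\<close>,
  whose squared norm is the sum over \<open>x\<close>.\<close>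

lemma norm_sym_kernel_basis:
  "(\<Sum>b\<in>Basis. (norm (sym_kernel P \<pi> *v b))\<^sup>2) = (\<Sum>x\<in>UNIV. \<Sum>y\<in>UNIV. pmf \<pi> x * (pmf (P x) y)\<^sup>2 / pmf \<pi> y)"
proof -
  have "(\<Sum>b\<in>Basis. (norm (sym_kernel P \<pi> *v b))\<^sup>2) = (\<Sum>y\<in>UNIV. (norm (sym_kernel P \<pi> *v axis y 1))\<^sup>2)"
    by (simp add: Basis_vec_def sum.UNION_disjoint axis_eq_axis)
  also have "\<dots> = (\<Sum>y\<in>UNIV. \<Sum>x\<in>UNIV. pmf \<pi> x * (pmf (P x) y)\<^sup>2 / pmf \<pi> y)"
    by (simp add: norm_vec_def L2_set_def sum_nonneg matrix_vector_mult_basis column_def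
        sym_kernel_def power_mult_distrib power_divide)
  finally show ?thesis by (subst sum.swap)
qed

lemma spectrum_identities:
  fixes P :: "'s::finite \<Rightarrow> 's pmf"
  assumes pos: "\<forall>x. pmf \<pi> x > 0" and rev: "reversible P \<pi>"
  shows "finite (spectrum_of P)" "(\<Sum>t\<in>spectrum_of P. dim (eigenspace P t)) = CARD('s)"
    "(\<Sum>t\<in>spectrum_of P. real (dim (eigenspace P t)) * t\<^sup>2)
       = (\<Sum>x\<in>UNIV. \<Sum>y\<in>UNIV. pmf \<pi> x * (pmf (P x) y)\<^sup>2 / pmf \<pi> y)"
  using selfadjoint_eigenspaces[OF matrix_vector_mul_linear sym_kernel_selfadjoint[OF pos rev]]
  unfolding spectrum_sym_kernel[OF pos] dim_eigenspace_sym_kernel[OF pos] norm_sym_kernel_basis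
  by auto

section \<open>The top eigenvalue of a Markov kernel\<close>

lemma sum_pmf_UNIV: "(\<Sum>y\<in>UNIV. pmf (p :: 's::finite pmf) y) = 1"
  by (rule sum_pmf_eq_1) auto

lemma one_in_spectrum: "1 \<in> spectrum_of P"
proof -
  \<comment> \<open>The eigenvector is the constant function, because each row of \<open>P\<close>
    sums to one.\<close>
  have "1 \<in> eigenspace P 1"
    by (simp add: eigenspace_def transition_op_def vec_eq_iff sum_pmf_UNIV)
  then show ?thesis unfolding spectrum_of_def by (intro CollectI bexI[of _ 1]) simp
qed

text \<open>Maximum principle: evaluate the eigenvalue equation where \<open>\<bar>f\<bar>\<close> is largest.\<close>

lemma spectrum_le_one:
  assumes "t \<in> spectrum_of P"
  shows "t \<le> 1"
proof -
  obtain f where f: "transition_op P f = t *\<^sub>R f" "f \<noteq> 0"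
    using assms by (auto simp: spectrum_of_def eigenspace_def)
  have "Max (range (\<lambda>y. \<bar>f $ y\<bar>)) \<in> range (\<lambda>y. \<bar>f $ y\<bar>)"
    by (rule Max_in) auto
  then obtain x where x': "Max (range (\<lambda>y. \<bar>f $ y\<bar>)) = \<bar>f $ x\<bar>" by (rule imageE)
  have x: "\<bar>f $ y\<bar> \<le> \<bar>f $ x\<bar>" for y
    unfolding x'[symmetric] by (rule Max_ge) auto
  have "f $ x \<noteq> 0" using f(2) x by (metis abs_le_zero_iff abs_zero vec_eq_iff zero_index)
  have "\<bar>t\<bar> * \<bar>f $ x\<bar> = \<bar>transition_op P f $ x\<bar>" by (simp add: f(1) abs_mult)
  also have "\<dots> \<le> (\<Sum>y\<in>UNIV. \<bar>pmf (P x) y * f $ y\<bar>)"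
    by (simp add: transition_op_def sum_abs)
  also have "\<dots> \<le> (\<Sum>y\<in>UNIV. pmf (P x) y * \<bar>f $ x\<bar>)"
    by (intro sum_mono) (simp add: abs_mult mult_left_mono x)
  also have "\<dots> = \<bar>f $ x\<bar>" by (simp add: sum_pmf_UNIV flip: sum_distrib_right)
  finally show ?thesis using \<open>f $ x \<noteq> 0\<close> by simp
qed

section \<open>Sums over the ordered list of eigenvalues\<close>

lemma sum_list_concat_replicate:
  fixes h :: "'a \<Rightarrow> 'b::semiring_1"
  shows "sum_list (map h (concat (map (\<lambda>t. replicate (k t) t) ts))) = (\<Sum>t\<leftarrow>ts. of_nat (k t) * h t)"
  by (induction ts) (auto simp: sum_list_replicate)

lemma eigenvalue_list_sums:
  assumes "finite (spectrum_of P)"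
  shows "length (eigenvalue_list P) = (\<Sum>t\<in>spectrum_of P. dim (eigenspace P t))"
    "(\<Sum>t\<leftarrow>eigenvalue_list P. t\<^sup>2) = (\<Sum>t\<in>spectrum_of P. real (dim (eigenspace P t)) * t\<^sup>2)"
proof -
  have *: "(\<Sum>t\<leftarrow>rev (sorted_list_of_set (spectrum_of P)). h t) = (\<Sum>t\<in>spectrum_of P. h t)"
    for h :: "real \<Rightarrow> 'b::comm_monoid_add"
    using assms by (subst sum_list_distinct_conv_sum_set) auto
  show "length (eigenvalue_list P) = (\<Sum>t\<in>spectrum_of P. dim (eigenspace P t))"
    unfolding eigenvalue_list_def by (simp only: length_concat map_map comp_def length_replicate *)
  show "(\<Sum>t\<leftarrow>eigenvalue_list P. t\<^sup>2) = (\<Sum>t\<in>spectrum_of P. real (dim (eigenspace P t)) * t\<^sup>2)"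
    unfolding eigenvalue_list_def sum_list_concat_replicate * ..
qed

text \<open>The list is decreasing, and \<open>1\<close> is an eigenvalue that no other exceeds.
  This lets the first eigenvalue be split off the spectral sum.\<close>

lemma hd_eigenvalue_list:
  assumes fin: "finite (spectrum_of P)"
  shows "\<exists>ts. eigenvalue_list P = 1 # ts"
proof -
  define l where "l = rev (sorted_list_of_set (spectrum_of P))"
  have set_l: "set l = spectrum_of P" using fin by (simp add: l_def)
  then obtain a l' where l: "l = a # l'" using one_in_spectrum[of P] by (cases l) auto
  have "sorted (rev l)" by (simp add: l_def)
  then have "1 \<le> a" using one_in_spectrum[of P] set_l l by (auto simp: sorted_append)
  then have "a = 1" using spectrum_le_one[of a P] set_l l by force
  \<comment> \<open>A nonzero multiplicity ensures that the leading \<open>replicate\<close> block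
    is not empty.\<close>
  have "dim (eigenspace P 1) \<noteq> 0"
    using one_in_spectrum[of P] by (auto simp: spectrum_of_def dim_eq_0)
  then obtain k where "dim (eigenspace P 1) = Suc k" by (cases "dim (eigenspace P 1)") auto
  then show ?thesis by (simp add: eigenvalue_list_def l \<open>a = 1\<close> flip: l_def)
qed

text \<open>The \<open>- 1\<close> is the square of the single leading entry; further copies of the
  eigenvalue \<open>1\<close>, if any, stay in the sum.\<close>

lemma sum_nontrivial_eigenval_sq:
  fixes P :: "'s::finite \<Rightarrow> 's pmf"
  assumes pos: "\<forall>x. pmf \<pi> x > 0" and rev: "reversible P \<pi>"
  shows "(\<Sum>i=2..CARD('s). (eigenval P i)\<^sup>2)
    = (\<Sum>x\<in>UNIV. \<Sum>y\<in>UNIV. pmf \<pi> x * (pmf (P x) y)\<^sup>2 / pmf \<pi> y) - 1"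
proof -
  note spec = spectrum_identities[OF pos rev]
  obtain ts where ts: "eigenvalue_list P = 1 # ts" using hd_eigenvalue_list[OF spec(1)] by blast
  have len: "CARD('s) = Suc (length ts)"
    using eigenvalue_list_sums(1)[OF spec(1)] spec(2) ts by simp
  \<comment> \<open>\<open>eigenval\<close> shifts the index by one and the head of the list by one
    more, so entry \<open>i\<close> sits at position \<open>i - 2\<close> of
    \<open>ts\<close>.\<close>
  have "(\<Sum>i=2..CARD('s). (eigenval P i)\<^sup>2) = (\<Sum>i\<in>{0..<length ts}. (ts ! i)\<^sup>2)"
    by (rule sum.reindex_bij_witness[of _ "\<lambda>i. i + 2" "\<lambda>i. i - 2"])
      (auto simp: len eigenval_def ts nth_Cons' numeral_2_eq_2)
  also have "\<dots> = (\<Sum>t\<leftarrow>ts. t\<^sup>2)" by (simp add: sum_list_sum_nth)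
  also have "\<dots> = (\<Sum>t\<leftarrow>eigenvalue_list P. t\<^sup>2) - 1" by (simp add: ts)
  finally show ?thesis using eigenvalue_list_sums(2)[OF spec(1)] spec(3) by simp
qed

section \<open>Entropy bounds\<close>

text \<open>This is \<open>ln (1 + g) \<le> g\<close> multiplied by the nonnegative
  \<open>1 + g\<close>; at \<open>g = -1\<close> both sides are zero.\<close>

lemma xlnx_upper:
  fixes g :: real
  assumes "-1 \<le> g"
  shows "(1 + g) * ln (1 + g) \<le> g + g\<^sup>2"
proof (cases "g = -1")
  case False
  then have "(1 + g) * ln (1 + g) \<le> (1 + g) * g"
    using assms by (intro mult_left_mono ln_add_one_self_le_self2) auto
  then show ?thesis by (simp add: algebra_simps power2_eq_square)
qed auto

text \<open>The difference of \<open>u ln u\<close> and its cubic Taylor polynomial at \<open>1\<close> is convex,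
  with second derivative \<open>(u - 1)\<^sup>2 / u\<close>.\<close>

lemma xlnx_lower:
  fixes g :: real
  assumes "-1 \<le> g"
  shows "g + g\<^sup>2 / 2 - \<bar>g\<bar> ^ 3 / 6 \<le> (1 + g) * ln (1 + g)"
proof (cases "g = -1")
  case False
  define h where "h = (\<lambda>u::real. u * ln u - (u - 1) - (u - 1)\<^sup>2 / 2 + (u - 1) ^ 3 / 6)"
  define h' where "h' = (\<lambda>u::real. ln u - (u - 1) + (u - 1)\<^sup>2 / 2)"
  \<comment> \<open>A convex function lies above its tangent at \<open>1\<close>; here
    \<open>h\<close> and \<open>h'\<close> both vanish there, so \<open>h (1 + g)\<close> is
    nonnegative.\<close>
  have "h' 1 * ((1 + g) - 1) \<le> h (1 + g) - h 1"
  proof (rule f''_imp_f'[of "{0<..}" h h' "\<lambda>u. 1 / u - 1 + (u - 1)"])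
    show "DERIV h u :> h' u" if "u \<in> {0<..}" for u
      unfolding h_def h'_def using that
      by (auto intro!: derivative_eq_intros simp: field_simps power2_eq_square)
    show "DERIV h' u :> 1 / u - 1 + (u - 1)" if "u \<in> {0<..}" for u
      unfolding h'_def using that by (auto intro!: derivative_eq_intros simp: field_simps)
    show "0 \<le> 1 / u - 1 + (u - 1)" if "u \<in> {0<..}" for u :: real
    proof -
      have "1 / u - 1 + (u - 1) = (u - 1)\<^sup>2 / u"
        using that by (simp add: field_simps power2_eq_square)
      then show ?thesis using that by simp
    qed
  qed (use assms False in auto)
  then have "0 \<le> (1 + g) * ln (1 + g) - g - g\<^sup>2 / 2 + g ^ 3 / 6"
    by (simp add: h_def h'_def)
  \<comment> \<open>The Taylor bound has the signed cube; passing to the absolute value only weakens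
    it.\<close>
  moreover have "g ^ 3 \<le> \<bar>g\<bar> ^ 3" by (metis abs_ge_self power_abs)
  ultimately show ?thesis by simp
qed auto

section \<open>Moments of the relative deviation and the mutual information\<close>

text \<open>Both \<open>P x\<close> and \<open>\<pi>\<close> have mass one. This removes the linear
  term from the two entropy bounds.\<close>

lemma sum_rel_dev:
  fixes P :: "'s::finite \<Rightarrow> 's pmf"
  assumes "\<forall>x. pmf \<pi> x > 0"
  shows "(\<Sum>y\<in>UNIV. pmf \<pi> y * rel_dev P \<pi> x y) = 0"
proof -
  have "pmf \<pi> y * rel_dev P \<pi> x y = pmf (P x) y - pmf \<pi> y" for y
    using assms[rule_format, of y] by (simp add: rel_dev_def field_simps)
  then show ?thesis by (simp add: sum_subtractf sum_pmf_UNIV)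
qed

text \<open>On expanding the square, the cross terms total \<open>- 2\<close> and the constant terms
  \<open>1\<close>.\<close>

lemma sum_rel_dev_sq:
  fixes P :: "'s::finite \<Rightarrow> 's pmf"
  assumes pos: "\<forall>x. pmf \<pi> x > 0"
  shows "(\<Sum>x\<in>UNIV. \<Sum>y\<in>UNIV. pmf \<pi> x * (pmf \<pi> y * (rel_dev P \<pi> x y)\<^sup>2))
    = (\<Sum>x\<in>UNIV. \<Sum>y\<in>UNIV. pmf \<pi> x * (pmf (P x) y)\<^sup>2 / pmf \<pi> y) - 1"
proof -
  have "pmf \<pi> x * (pmf \<pi> y * (rel_dev P \<pi> x y)\<^sup>2)
     = pmf \<pi> x * (pmf (P x) y)\<^sup>2 / pmf \<pi> y - 2 * (pmf \<pi> x * pmf (P x) y) + pmf \<pi> x * pmf \<pi> y" for x y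
    using pos[rule_format, of y] by (simp add: rel_dev_def power2_eq_square field_simps)
  then show ?thesis
    by (simp add: sum.distrib sum_subtractf sum_pmf_UNIV flip: sum_distrib_left)
qed

text \<open>\<open>1 + rel_dev P \<pi> x y\<close> is the density of \<open>P x\<close> with respect
  to \<open>\<pi>\<close>, so the information is an average of \<open>u * ln u\<close>.\<close>

lemma one_step_info_rel_dev:
  fixes P :: "'s::finite \<Rightarrow> 's pmf"
  assumes pos: "\<forall>x. pmf \<pi> x > 0"
  shows "one_step_info P \<pi>
    = (\<Sum>x\<in>UNIV. \<Sum>y\<in>UNIV. pmf \<pi> x * (pmf \<pi> y * ((1 + rel_dev P \<pi> x y) * ln (1 + rel_dev P \<pi> x y))))"
proof -
  have "pmf \<pi> y \<noteq> 0" for y using pos[rule_format, of y] by simp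
  then show ?thesis by (simp add: one_step_info_def rel_dev_def mult.assoc)
qed

lemma rel_dev_ge: "-1 \<le> rel_dev P \<pi> x y"
  by (simp add: rel_dev_def)

lemma one_step_info_upper:
  fixes P :: "'s::finite \<Rightarrow> 's pmf"
  assumes pos: "\<forall>x. pmf \<pi> x > 0"
  shows "one_step_info P \<pi> \<le> (\<Sum>x\<in>UNIV. \<Sum>y\<in>UNIV. pmf \<pi> x * (pmf \<pi> y * (rel_dev P \<pi> x y)\<^sup>2))"
proof -
  have "one_step_info P \<pi>
      \<le> (\<Sum>x\<in>UNIV. \<Sum>y\<in>UNIV. pmf \<pi> x * (pmf \<pi> y * (rel_dev P \<pi> x y + (rel_dev P \<pi> x y)\<^sup>2)))"
    unfolding one_step_info_rel_dev[OF pos]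
    by (intro sum_mono mult_left_mono xlnx_upper rel_dev_ge) auto
  also have "\<dots> = (\<Sum>x\<in>UNIV. \<Sum>y\<in>UNIV. pmf \<pi> x * (pmf \<pi> y * (rel_dev P \<pi> x y)\<^sup>2))"
    by (simp add: distrib_left sum.distrib sum_rel_dev[OF pos] flip: sum_distrib_left)
  finally show ?thesis .
qed

text \<open>Averaging \<open>xlnx_lower\<close> kills the linear term and turns the cubic one into
  \<open>T3\<close>.\<close>

lemma one_step_info_lower:
  fixes P :: "'s::finite \<Rightarrow> 's pmf"
  assumes pos: "\<forall>x. pmf \<pi> x > 0"
  shows "(1/2) * (\<Sum>x\<in>UNIV. \<Sum>y\<in>UNIV. pmf \<pi> x * (pmf \<pi> y * (rel_dev P \<pi> x y)\<^sup>2))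
    - (1/6) * (\<Sum>x\<in>UNIV. pmf \<pi> x * T3 P \<pi> x) \<le> one_step_info P \<pi>"
proof -
  have "(\<Sum>y\<in>UNIV. pmf \<pi> y * (rel_dev P \<pi> x y + (rel_dev P \<pi> x y)\<^sup>2 / 2 - \<bar>rel_dev P \<pi> x y\<bar> ^ 3 / 6))
    = (1/2) * (\<Sum>y\<in>UNIV. pmf \<pi> y * (rel_dev P \<pi> x y)\<^sup>2) - (1/6) * T3 P \<pi> x" for x
    by (simp add: T3_def right_diff_distrib distrib_left sum.distrib sum_subtractf sum_rel_dev[OF pos]
        sum_divide_distrib)
  then have "(\<Sum>x\<in>UNIV. pmf \<pi> x * (\<Sum>y\<in>UNIV. pmf \<pi> y *
        (rel_dev P \<pi> x y + (rel_dev P \<pi> x y)\<^sup>2 / 2 - \<bar>rel_dev P \<pi> x y\<bar> ^ 3 / 6)))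
    = (\<Sum>x\<in>UNIV. (1/2) * (pmf \<pi> x * (\<Sum>y\<in>UNIV. pmf \<pi> y * (rel_dev P \<pi> x y)\<^sup>2))
        - (1/6) * (pmf \<pi> x * T3 P \<pi> x))"
    by (simp only: right_diff_distrib mult.left_commute)
  then have "(1/2) * (\<Sum>x\<in>UNIV. \<Sum>y\<in>UNIV. pmf \<pi> x * (pmf \<pi> y * (rel_dev P \<pi> x y)\<^sup>2))
      - (1/6) * (\<Sum>x\<in>UNIV. pmf \<pi> x * T3 P \<pi> x)
    = (\<Sum>x\<in>UNIV. \<Sum>y\<in>UNIV. pmf \<pi> x * (pmf \<pi> y *
        (rel_dev P \<pi> x y + (rel_dev P \<pi> x y)\<^sup>2 / 2 - \<bar>rel_dev P \<pi> x y\<bar> ^ 3 / 6)))"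
    by (simp only: sum_subtractf sum_distrib_left)
  also have "\<dots> \<le> one_step_info P \<pi>"
    unfolding one_step_info_rel_dev[OF pos]
    by (intro sum_mono mult_left_mono xlnx_lower rel_dev_ge) auto
  finally show ?thesis .
qed

text \<open>One factor of the cube is bounded by \<open>C\<close>, which leaves the square.\<close>

lemma T3_le:
  fixes P :: "'s::finite \<Rightarrow> 's pmf"
  assumes "\<forall>x y. \<bar>rel_dev P \<pi> x y\<bar> \<le> C"
  shows "(\<Sum>x\<in>UNIV. pmf \<pi> x * T3 P \<pi> x)
    \<le> C * (\<Sum>x\<in>UNIV. \<Sum>y\<in>UNIV. pmf \<pi> x * (pmf \<pi> y * (rel_dev P \<pi> x y)\<^sup>2))"
proof -
  have "\<bar>rel_dev P \<pi> x y\<bar> ^ 3 \<le> C * (rel_dev P \<pi> x y)\<^sup>2" for x y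
    using mult_right_mono[OF assms[rule_format, of x y], of "(rel_dev P \<pi> x y)\<^sup>2"]
    by (simp add: power3_eq_cube power2_eq_square abs_mult_self_eq mult.assoc)
  then have "(\<Sum>x\<in>UNIV. pmf \<pi> x * T3 P \<pi> x)
    \<le> (\<Sum>x\<in>UNIV. pmf \<pi> x * (\<Sum>y\<in>UNIV. pmf \<pi> y * (C * (rel_dev P \<pi> x y)\<^sup>2)))"
    unfolding T3_def by (intro sum_mono mult_left_mono) auto
  also have "\<dots> = C * (\<Sum>x\<in>UNIV. \<Sum>y\<in>UNIV. pmf \<pi> x * (pmf \<pi> y * (rel_dev P \<pi> x y)\<^sup>2))"
    by (simp add: sum_distrib_left mult.left_commute)
  finally show ?thesis .
qed

theorem corollary5p5:
  fixes P :: "'s::finite \<Rightarrow> 's pmf" and \<pi> :: "'s pmf"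
  assumes "CARD('s) \<ge> 2"
    and stationary: "bind_pmf \<pi> P = \<pi>"
    and full_support: "\<forall>x. pmf \<pi> x > 0"
    and reversible: "reversible P \<pi>"
  shows "(1/2) * (\<Sum>i=2..CARD('s). (eigenval P i)\<^sup>2)
           - (1/6) * (\<Sum>x\<in>UNIV. pmf \<pi> x * T3 P \<pi> x) \<le> one_step_info P \<pi>
       \<and> one_step_info P \<pi> \<le> (\<Sum>i=2..CARD('s). (eigenval P i)\<^sup>2)
       \<and> (\<forall>C::real. (\<forall>x y. \<bar>rel_dev P \<pi> x y\<bar> \<le> C) \<longrightarrow>
            (\<Sum>x\<in>UNIV. pmf \<pi> x * T3 P \<pi> x) \<le> C * (\<Sum>i=2..CARD('s). (eigenval P i)\<^sup>2)
          \<and> one_step_info P \<pi> \<ge> (1/2 - C/6) * (\<Sum>i=2..CARD('s). (eigenval P i)\<^sup>2)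
          \<and> (C < 3 \<longrightarrow> 1/2 - C/6 > 0
               \<and> ((\<exists>i\<in>{2..CARD('s)}. eigenval P i \<noteq> 0) \<longrightarrow>
                    (1/2 - C/6) * (\<Sum>i=2..CARD('s). (eigenval P i)\<^sup>2) > 0)))"
proof -
  define S where "S = (\<Sum>i=2..CARD('s). (eigenval P i)\<^sup>2)"
  \<comment> \<open>Spectral sum and mean square deviation are both the same double sum minus
    one.\<close>
  have S: "S = (\<Sum>x\<in>UNIV. \<Sum>y\<in>UNIV. pmf \<pi> x * (pmf \<pi> y * (rel_dev P \<pi> x y)\<^sup>2))"
    unfolding S_def sum_nontrivial_eigenval_sq[OF full_support reversible] sum_rel_dev_sq[OF full_support] ..
  note bounds = one_step_info_lower[OF full_support, of P, folded S]
    one_step_info_upper[OF full_support, of P, folded S]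
  have T3: "(\<Sum>x\<in>UNIV. pmf \<pi> x * T3 P \<pi> x) \<le> C * S"
    and low: "(1/2 - C/6) * S \<le> one_step_info P \<pi>" if "\<forall>x y. \<bar>rel_dev P \<pi> x y\<bar> \<le> C" for C
    using T3_le[OF that, folded S] bounds(1) by (auto simp: algebra_simps)
  \<comment> \<open>\<open>C < 3\<close> makes the first factor positive; one nonzero nontrivial
    eigenvalue gives \<open>S\<close> a positive summand.\<close>
  have "(1/2 - C/6) * S > 0" if "C < 3" "i \<in> {2..CARD('s)}" "eigenval P i \<noteq> 0" for C i
    using that unfolding S_def by (intro mult_pos_pos sum_pos2[of _ i]) auto
  then show ?thesis
    using bounds T3 low unfolding S_def[symmetric] by auto
qed

end
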